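(* Let $G$ be a parity game and let $\pi_1,\pi_2$ be finite sequences of colors of $G$ such that $\mathtt{psolB}(\pi_1)$ and $\mathtt{psolB}(\pi_2)$ are both stable. For $i\in\{1,2\}$ let $G_i$ be the output of $\mathtt{psolB}(\pi_i)$ on input $G$. Then $G_1=G_2$.
   Context: A parity game is a tuple $G=(V,V_0,V_1,E,c)$ where $V$ is a finite set of nodes partitioned into $V_0,V_1$, $E\subseteq V\times V$ with every node having a successor, and $c\colon V\to\mathbb{N}$. Let $v.E=\{w\mid(v,w)\in E\}$. For $U\subseteq V$, $H\setminus U$ is the game $H$ restricted to the complement of $U$. $\mathrm{Attr}_p(H,X)$ is the least fixed point of $Z\mapsto X\cup\{v\in V_p\mid v.E\cap Z\ne\emptyset\}\cup\{v\in V_{1-p}\mid v.E\subseteq Z\}$ in $H$. Let $\mathrm{mpre}_p(A,X,d)=\{v\in V_p\mid c(v)\geq d \wedge v.E\cap(A\cup X)\neq\emptyset\}\cup\{v\in V_{1-p}\mid c(v)\geq d\wedge v.E\subseteq A\cup X\}$; for a nonempty set $X$ of nodes of common color $d$, $\mathrm{MAttr}_H(X)$ is the least fixed point of $Z\mapsto\mathrm{mpre}_{d\bmod 2}(Z,X,d)$ computed in game $H$. Applying color $d$ to a game $H$: let $X$ be the set of nodes of $H$ of color $d$; repeat: if $X=\emptyset$, the result is $H$; if $X\subseteq\mathrm{MAttr}_H(X)$ (a fatal attractor), the result is $H\setminus\mathrm{Attr}_{d\bmod 2}(H,\mathrm{MAttr}_H(X))$; otherwise set $X:=X\cap\mathrm{MAttr}_H(X)$.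 For a finite sequence $\pi$ of colors (possibly omitting or repeating colors), $\mathtt{psolB}(\pi)$ is the procedure that, starting from the input game, applies the colors of $\pi$ one after another in the order of $\pi$ and outputs the resulting game. $\mathtt{psolB}(\pi)$ is stable if for every color $c_1$ the procedures $\mathtt{psolB}(\pi)$ and $\mathtt{psolB}(\pi\cdot c_1)$ have the same input/output behavior. *)

theory Defs
  imports Main "HOL-Library.While_Combinator"
begin

record 'v game =
  nodes :: "'v set"
  nodes0 :: "'v set"
  nodes1 :: "'v set"
  edges :: "('v \<times> 'v) set"
  color :: "'v \<Rightarrow> nat"

definition parity_game :: "'v game \<Rightarrow> bool" where
  "parity_game G \<longleftrightarrow>
     finite (nodes G) \<and>
     nodes0 G \<union> nodes1 G = nodes G \<and> nodes0 G \<inter> nodes1 G = {} \<and>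
     edges G \<subseteq> nodes G \<times> nodes G \<and>
     (\<forall>v\<in>nodes G. \<exists>w. (v, w) \<in> edges G)"

definition colors :: "'v game \<Rightarrow> nat set" where
  "colors G = color G ` nodes G"

text \<open>Players are the numbers 0 and 1; the opponent of \<open>p\<close> is \<open>1 - p\<close>.\<close>

definition nodes_of :: "'v game \<Rightarrow> nat \<Rightarrow> 'v set" where
  "nodes_of G p = (if p = 0 then nodes0 G else nodes1 G)"

definition succs :: "'v game \<Rightarrow> 'v \<Rightarrow> 'v set" where
  "succs G v = edges G `` {v}"

text \<open>The coloring is a total function whose values off the node set carry no meaning, so
  restricting a game leaves it as it is.\<close>

definition remove :: "'v game \<Rightarrow> 'v set \<Rightarrow> 'v game" where
  "remove H U =
     \<lparr> nodes = nodes H - U,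
       nodes0 = nodes0 H - U,
       nodes1 = nodes1 H - U,
       edges = {(v, w) \<in> edges H. v \<notin> U \<and> w \<notin> U},
       color = color H \<rparr>"

definition Attr :: "nat \<Rightarrow> 'v game \<Rightarrow> 'v set \<Rightarrow> 'v set" where
  "Attr p H X =
     lfp (\<lambda>Z. X \<union> {v \<in> nodes_of H p. succs H v \<inter> Z \<noteq> {}}
               \<union> {v \<in> nodes_of H (1 - p). succs H v \<subseteq> Z})"

definition mpre :: "'v game \<Rightarrow> nat \<Rightarrow> 'v set \<Rightarrow> 'v set \<Rightarrow> nat \<Rightarrow> 'v set" where
  "mpre H p A X d =
     {v \<in> nodes_of H p. color H v \<ge> d \<and> succs H v \<inter> (A \<union> X) \<noteq> {}} \<union>
     {v \<in> nodes_of H (1 - p). color H v \<ge> d \<and> succs H v \<subseteq> A \<union> X}"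

text \<open>The argument \<open>d\<close> is the common color of the nodes in \<open>X\<close>.\<close>

definition MAttr :: "'v game \<Rightarrow> nat \<Rightarrow> 'v set \<Rightarrow> 'v set" where
  "MAttr H d X = lfp (\<lambda>Z. mpre H (d mod 2) Z X d)"

text \<open>The loop stops at a set that is empty or inside its own monotone attractor. It does stop
  for a finite game, since \<open>X\<close> shrinks strictly in every round.\<close>

definition fatal_target :: "'v game \<Rightarrow> nat \<Rightarrow> 'v set" where
  "fatal_target H d =
     while (\<lambda>X. X \<noteq> {} \<and> \<not> X \<subseteq> MAttr H d X) (\<lambda>X. X \<inter> MAttr H d X)
       {v \<in> nodes H. color H v = d}"

definition apply_color :: "nat \<Rightarrow> 'v game \<Rightarrow> 'v game" where
  "apply_color d H =
     (let X = fatal_target H d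
      in if X = {} then H else remove H (Attr (d mod 2) H (MAttr H d X)))"

definition psolB :: "nat list \<Rightarrow> 'v game \<Rightarrow> 'v game" where
  "psolB \<pi> G = fold apply_color \<pi> G"

text \<open>Input/output behavior is compared on the input game \<open>G\<close>, with \<open>c1\<close> ranging over the colors
  of \<open>G\<close>. No finite sequence passes the comparison for all games and all colors: if \<open>c1\<close> does
  not occur in \<open>\<pi>\<close>, the game with one node, of color \<open>c1\<close>, and a self-loop is left unchanged
  by \<open>psolB \<pi>\<close> and emptied by \<open>psolB (\<pi> @ [c1])\<close>. Being stable on \<open>G\<close> is the weaker property
  (\<open>stable_onI\<close>), so assuming only that gives the stronger uniqueness result.\<close>

definition stable_on :: "'v game \<Rightarrow> nat list \<Rightarrow> bool" where
  "stable_on G \<pi> \<longleftrightarrow> (\<forall>c1\<in>colors G. psolB (\<pi> @ [c1]) G = psolB \<pi> G)"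

lemma stable_onI:
  fixes G :: "'v game"
  assumes "parity_game G"
    and "\<And>(H :: 'v game) c1. parity_game H \<Longrightarrow> c1 \<in> colors G \<Longrightarrow> psolB (\<pi> @ [c1]) H = psolB \<pi> H"
  shows "stable_on G \<pi>"
  unfolding stable_on_def using assms by blast

end

theory Submission
  imports Defs
begin

text \<open>
  The set removed for player \<open>p\<close> by a run of \<open>psolB\<close> is built from layers, each an attractor of a
  fatal attractor, and plays confined to it can only move to the same or an earlier layer. A set
  removed for player 0 by one run and a set removed for player 1 by another are disjoint: in the
  first pair of layers that meet, the two target colors would bound each other from below, hence be
  equal, although their parities differ.

  Now let \<open>K\<close> be the output of a stable run and \<open>H\<close> a game of another run with \<open>K \<subseteq> H\<close>. What
  \<open>H\<close> loses to player \<open>p\<close> next meets nothing that \<open>K\<close> lost to the opponent, and no node of \<open>p\<close>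
  in \<open>K\<close> has an edge into what \<open>K\<close> lost to \<open>p\<close>. So a fatal attractor of \<open>H\<close> restricts to one of
  \<open>K\<close>, which has none, and the removed attractor misses \<open>K\<close>. By induction the output of every run
  contains that of every stable run.
\<close>

section \<open>Attractors, monotone attractors and subgames\<close>

lemma Attr_mono:
  "mono (\<lambda>Z. X \<union> {v \<in> nodes_of H p. succs H v \<inter> Z \<noteq> {}}
               \<union> {v \<in> nodes_of H (1 - p). succs H v \<subseteq> Z})"
  by (rule monoI) blast

lemma Attr_unfold:
  "Attr p H X = X \<union> {v \<in> nodes_of H p. succs H v \<inter> Attr p H X \<noteq> {}}
                 \<union> {v \<in> nodes_of H (1 - p). succs H v \<subseteq> Attr p H X}"
  unfolding Attr_def by (rule lfp_unfold[OF Attr_mono])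

lemma Attr_induct [consumes 1, case_names target own opponent]:
  assumes "v \<in> Attr p H X"
    and "\<And>v. v \<in> X \<Longrightarrow> P v"
    and "\<And>v w. v \<in> nodes_of H p \<Longrightarrow> w \<in> succs H v \<Longrightarrow> w \<in> Attr p H X \<Longrightarrow> P w \<Longrightarrow> P v"
    and "\<And>v. v \<in> nodes_of H (1 - p) \<Longrightarrow> (\<And>w. w \<in> succs H v \<Longrightarrow> w \<in> Attr p H X \<and> P w) \<Longrightarrow> P v"
  shows "P v"
  using assms(1) unfolding Attr_def
  by (rule lfp_induct_set[OF _ Attr_mono]) (fold Attr_def, use assms(2-) in blast)

lemma mpre_mono: "mono (\<lambda>Z. mpre H p Z X d)"
  by (rule monoI) (unfold mpre_def, blast)

lemma MAttr_unfold: "MAttr H d X = mpre H (d mod 2) (MAttr H d X) X d"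
  unfolding MAttr_def by (rule lfp_unfold[OF mpre_mono])

lemma MAttr_mono: "X \<subseteq> Y \<Longrightarrow> MAttr H d X \<subseteq> MAttr H d Y"
  unfolding MAttr_def by (rule lfp_mono) (unfold mpre_def, blast)

text \<open>The target \<open>X\<close> is not put into the fixed point, so a successor in
  \<open>X\<close> comes without an induction hypothesis.\<close>

lemma MAttr_induct [consumes 1, case_names own opponent]:
  assumes "v \<in> MAttr H d X"
    and "\<And>v w. v \<in> nodes_of H (d mod 2) \<Longrightarrow> d \<le> color H v \<Longrightarrow> w \<in> succs H v \<Longrightarrow>
           w \<in> X \<or> w \<in> MAttr H d X \<and> P w \<Longrightarrow> P v"
    and "\<And>v. v \<in> nodes_of H (1 - d mod 2) \<Longrightarrow> d \<le> color H v \<Longrightarrow>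
           (\<And>w. w \<in> succs H v \<Longrightarrow> w \<in> X \<or> w \<in> MAttr H d X \<and> P w) \<Longrightarrow> P v"
  shows "P v"
  using assms(1) unfolding MAttr_def
proof (rule lfp_induct_set[OF _ mpre_mono], fold MAttr_def)
  fix x assume "x \<in> mpre H (d mod 2) (MAttr H d X \<inter> {x. P x}) X d"
  then show "P x"
    unfolding mpre_def using assms(2)[of x] assms(3)[of x] by blast
qed

lemma parity_gameD:
  assumes "parity_game G"
  shows "finite (nodes G)" "nodes_of G p \<subseteq> nodes G"
    "p < 2 \<Longrightarrow> nodes G = nodes_of G p \<union> nodes_of G (1 - p)"
    "p < 2 \<Longrightarrow> nodes_of G p \<inter> nodes_of G (1 - p) = {}"
    "succs G v \<subseteq> nodes G" "v \<in> nodes G \<Longrightarrow> succs G v \<noteq> {}"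
  using assms unfolding parity_game_def nodes_of_def succs_def by auto

lemma remove_simps [simp]:
  "nodes (remove G R) = nodes G - R"
  "nodes_of (remove G R) p = nodes_of G p - R"
  "color (remove G R) = color G"
  "v \<notin> R \<Longrightarrow> succs (remove G R) v = succs G v - R"
  "remove (remove G R) S = remove G (R \<union> S)"
  by (auto simp: remove_def nodes_of_def succs_def)

lemma parity_game_remove:
  assumes "parity_game G" "\<And>v. v \<in> nodes G - R \<Longrightarrow> succs G v - R \<noteq> {}"
  shows "parity_game (remove G R)"
  using assms unfolding parity_game_def remove_def succs_def by fastforce

lemma MAttr_subset_nodes: "parity_game H \<Longrightarrow> MAttr H d X \<subseteq> nodes H"
  by (subst MAttr_unfold) (use parity_gameD(2)[of H] in \<open>auto simp: mpre_def\<close>)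

text \<open>With nothing to reach, only a dead end could be the first node to enter, and a game has
  no dead ends.\<close>

lemma MAttr_empty:
  assumes "parity_game H" shows "MAttr H d {} = {}"
proof -
  have False if "v \<in> MAttr H d {}" for v
    using that
  proof (induction rule: MAttr_induct)
    case (own v w)
    then show ?case by blast
  next
    case (opponent v)
    then have "succs H v = {}" by blast
    then show ?case using opponent(1) parity_gameD(2,6)[OF assms] by blast
  qed
  then show ?thesis by blast
qed

section \<open>Fatal attractors\<close>

definition fatal :: "'v game \<Rightarrow> nat \<Rightarrow> 'v set \<Rightarrow> bool" where
  "fatal H d X \<longleftrightarrow> X \<subseteq> {v \<in> nodes H. color H v = d} \<and> X \<subseteq> MAttr H d X"

text \<open>\<open>MAttr\<close> is monotone in its target, so a round of the loop never discards a
  node of a fatal subset; the loop ends at the greatest fatal set.\<close>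

lemma fatal_target:
  assumes "parity_game H"
  shows "fatal H d (fatal_target H d)"
    and "fatal H d Y \<Longrightarrow> Y \<subseteq> fatal_target H d"
proof -
  let ?N = "{v \<in> nodes H. color H v = d}"
  let ?P = "\<lambda>X. X \<subseteq> ?N \<and> (\<forall>Y. fatal H d Y \<longrightarrow> Y \<subseteq> X)"
  have fin: "finite (nodes H)" using parity_gameD(1)[OF assms] .
  let ?Q = "\<lambda>X. fatal H d X \<and> (\<forall>Y. fatal H d Y \<longrightarrow> Y \<subseteq> X)"
  have "?Q (fatal_target H d)"
    unfolding fatal_target_def
  proof (rule while_rule[where P = ?P and r = "measure card"])
    fix X assume P: "?P X" and X: "X \<noteq> {} \<and> \<not> X \<subseteq> MAttr H d X"
    have "Y \<subseteq> X \<inter> MAttr H d X" if Y: "fatal H d Y" for Y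
    proof -
      have "Y \<subseteq> X" using P Y by blast
      moreover have "Y \<subseteq> MAttr H d Y" using Y by (simp add: fatal_def)
      ultimately show ?thesis using MAttr_mono[of Y X H d] by blast
    qed
    then show "?P (X \<inter> MAttr H d X)" using P by (simp add: le_infI1)
    have "X \<subseteq> nodes H" using P by blast
    then have "finite X" using fin by (rule finite_subset)
    moreover have "X \<inter> MAttr H d X \<subset> X" using X by blast
    ultimately show "(X \<inter> MAttr H d X, X) \<in> measure card"
      by (simp add: psubset_card_mono)
  qed (auto simp: fatal_def)
  then show "fatal H d (fatal_target H d)"
    and "fatal H d Y \<Longrightarrow> Y \<subseteq> fatal_target H d" by auto
qed

lemma no_fatal_if_apply_color_eq:
  assumes "parity_game H" "apply_color d H = H" "fatal H d Y"
  shows "Y = {}"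
proof (rule ccontr)
  let ?X = "fatal_target H d"
  assume "Y \<noteq> {}"
  then obtain v where v: "v \<in> ?X" using fatal_target(2)[OF assms(1,3)] by blast
  then have "v \<in> MAttr H d ?X" "v \<in> nodes H"
    using fatal_target(1)[OF assms(1), of d] unfolding fatal_def by auto
  then have "v \<in> Attr (d mod 2) H (MAttr H d ?X)" by (subst Attr_unfold) simp
  moreover have "H = remove H (Attr (d mod 2) H (MAttr H d ?X))"
    using assms(2) v by (auto simp: apply_color_def Let_def split: if_splits)
  then have "nodes H = nodes H - Attr (d mod 2) H (MAttr H d ?X)"
    by (metis remove_simps(1))
  ultimately show False using \<open>v \<in> nodes H\<close> by blast
qed

section \<open>Traps and winning certificates\<close>

text \<open>It is \<open>p\<close> who cannot leave \<open>Q\<close>; the opponent is able to stay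
  inside.\<close>

definition trap :: "nat \<Rightarrow> 'v game \<Rightarrow> 'v set \<Rightarrow> bool" where
  "trap p G Q \<longleftrightarrow> Q \<subseteq> nodes G \<and>
     (\<forall>v \<in> Q \<inter> nodes_of G p. succs G v \<subseteq> Q) \<and>
     (\<forall>v \<in> Q \<inter> nodes_of G (1 - p). succs G v \<inter> Q \<noteq> {})"

text \<open>A certificate, relative to the input game, that player \<open>p\<close> wins from a set. In a layer, \<open>A\<close>
  is the attractor of the monotone attractor \<open>Z\<close> of \<open>X\<close>. The last premise says that the opponent
  cannot confine the play to a set that meets \<open>A\<close> but neither \<open>X\<close> nor the earlier layers.\<close>

inductive won :: "nat \<Rightarrow> 'v game \<Rightarrow> 'v set \<Rightarrow> bool" for p G where
  empty: "won p G {}"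
| layer: "won p G (W \<union> A)"
  if "won p G W" "trap (1 - p) G (W \<union> A)" "trap (1 - p) G (W \<union> Z)" "X \<subseteq> Z" "Z \<subseteq> A"
    "\<forall>v\<in>Z. d \<le> color G v" "\<forall>v\<in>X. color G v = d" "d mod 2 = p"
    "\<forall>Q. trap p G Q \<longrightarrow> Q \<inter> W = {} \<longrightarrow> Q \<inter> A \<noteq> {} \<longrightarrow> Q \<inter> X \<noteq> {}"

lemma won_subset: "won p G W \<Longrightarrow> W \<subseteq> nodes G"
  by (induction rule: won.induct) (auto simp: trap_def)

lemma won_disjoint:
  assumes "won p G W" "won (1 - p) G U" "p < 2"
  shows "W \<inter> U = {}"
  using assms(1,2)
proof (induction arbitrary: U rule: won.induct)
  case empty
  then show ?case by simp
next
  case (layer W A Z X d)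
  note outer = layer
  have q: "1 - (1 - p) = p" using assms(3) by simp
  from outer(11) show ?case
  proof (induction rule: won.induct)
    case empty
    then show ?case by simp
  next
    case (layer U B Z' X' d')
    have U: "(W \<union> A) \<inter> U = {}" by fact
    \<comment> \<open>The outer hypothesis holds for every set certified for the opponent, hence for
      the enlarged one; only \<open>A\<close> and \<open>B\<close> can still meet.\<close>
    have W: "W \<inter> (U \<union> B) = {}"
      by (rule outer(10)) (rule won.layer[OF layer(1-9)])
    show ?case
    proof (rule ccontr)
      assume "(W \<union> A) \<inter> (U \<union> B) \<noteq> {}"
      then have AB: "A \<inter> B \<noteq> {}" using U W by blast
      \<comment> \<open>The opponent can stay in \<open>U \<union> B\<close>, which meets
        \<open>A\<close> but not \<open>W\<close>, so the certificate for \<open>p\<close> makes it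
        meet \<open>X\<close>.\<close>
      have "(U \<union> B) \<inter> X \<noteq> {}"
        using outer(9) layer(2) W AB unfolding q by blast
      then have XB: "X \<inter> B \<noteq> {}" using U outer(4,5) by blast
      have "(W \<union> A) \<inter> X' \<noteq> {}"
        using layer(9) outer(2) U AB by blast
      then have X'A: "X' \<inter> A \<noteq> {}" using W layer(4,5) by blast
      \<comment> \<open>The same argument with the smaller trap \<open>W \<union> Z\<close> puts a
        node of color \<open>d'\<close> into \<open>Z\<close>, where colors are at least
        \<open>d\<close>.\<close>
      have "(W \<union> Z) \<inter> X' \<noteq> {}"
        using layer(9) outer(3-5) U XB by blast
      then have "Z \<inter> X' \<noteq> {}" using W layer(4,5) by blast
      then have "d \<le> d'" using outer(6) layer(7) by auto
      have "(U \<union> Z') \<inter> X \<noteq> {}"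
        using outer(9) layer(3-5) W X'A unfolding q by blast
      then have "Z' \<inter> X \<noteq> {}" using U outer(4,5) by blast
      then have "d' \<le> d" using layer(6) outer(7) by auto
      with \<open>d \<le> d'\<close> have "d = d'" by simp
      moreover have "d mod 2 \<noteq> 1 - d mod 2" by presburger
      ultimately show False using outer(8) layer(8) by simp
    qed
  qed
qed

text \<open>\<open>R p\<close> is what has been removed for player \<open>p\<close>. Only the values at 0 and 1 matter.\<close>

definition solved :: "'v game \<Rightarrow> (nat \<Rightarrow> 'v set) \<Rightarrow> 'v game \<Rightarrow> bool" where
  "solved G R H \<longleftrightarrow> parity_game G \<and> parity_game H \<and> H = remove G (R 0 \<union> R 1) \<and>
     (\<forall>p<2. won p G (R p) \<and> (\<forall>v\<in>nodes_of H p. succs G v \<inter> R p = {}))"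

lemma solvedD:
  assumes "solved G R H" "p < 2"
  shows "parity_game G" "parity_game H" "H = remove G (R p \<union> R (1 - p))"
    "won p G (R p)" "won (1 - p) G (R (1 - p))"
    "v \<in> nodes_of H p \<Longrightarrow> succs G v \<inter> R p = {}"
    "v \<in> nodes_of H (1 - p) \<Longrightarrow> succs G v \<inter> R (1 - p) = {}"
proof -
  have "p = 0 \<or> p = 1" "1 - p < 2" using assms(2) by auto
  then show "parity_game G" "parity_game H" "H = remove G (R p \<union> R (1 - p))"
    "won p G (R p)" "won (1 - p) G (R (1 - p))"
    "v \<in> nodes_of H p \<Longrightarrow> succs G v \<inter> R p = {}"
    "v \<in> nodes_of H (1 - p) \<Longrightarrow> succs G v \<inter> R (1 - p) = {}"
    using assms unfolding solved_def by (auto simp: Un_commute)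
qed

text \<open>\<open>A\<close> becomes the next layer above \<open>R p\<close>. Statements about
  \<open>H\<close> lift to \<open>G\<close> because an opponent node of \<open>H\<close> has no edge
  into \<open>R (1 - p)\<close>: the edges it has lost all lead into \<open>R p\<close>.\<close>

lemma solved_update:
  assumes H: "solved G R H" and fatal: "fatal H d X" and p: "p = d mod 2"
    and A: "A = Attr p H (MAttr H d X)"
  shows "solved G (R(p := R p \<union> A)) (remove H A)"
proof -
  have p2: "p < 2" using p by simp
  note HD = solvedD[OF H p2]
  let ?Z = "MAttr H d X"
  have q: "1 - (1 - p) = p" using p2 by simp
  have XZ: "X \<subseteq> ?Z" and Xd: "\<forall>v\<in>X. color H v = d" using fatal unfolding fatal_def by auto
  have ZA: "?Z \<subseteq> A" unfolding A by (subst Attr_unfold) blast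
  \<comment> \<open>As \<open>X \<subseteq> ?Z\<close>, the union with \<open>X\<close> in
    \<open>mpre\<close> is absorbed: in \<open>H\<close>, \<open>p\<close> can keep the play inside
    \<open>?Z\<close>.\<close>
  have Z: "v \<in> nodes_of H p \<and> d \<le> color H v \<and> succs H v \<inter> ?Z \<noteq> {} \<or>
           v \<in> nodes_of H (1 - p) \<and> d \<le> color H v \<and> succs H v \<subseteq> ?Z" if "v \<in> ?Z" for v
    using that XZ unfolding p by (subst (asm) MAttr_unfold) (auto simp: mpre_def)
  have A_cases: "v \<in> nodes_of H p \<and> succs H v \<inter> A \<noteq> {} \<or>
           v \<in> nodes_of H (1 - p) \<and> succs H v \<subseteq> A" if "v \<in> A" for v
    using that Z[of v] ZA unfolding A by (subst (asm) Attr_unfold) blast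
  have AI: "v \<in> nodes_of H p \<Longrightarrow> succs H v \<inter> A \<noteq> {} \<Longrightarrow> v \<in> A"
       "v \<in> nodes_of H (1 - p) \<Longrightarrow> succs H v \<subseteq> A \<Longrightarrow> v \<in> A" for v
    unfolding A by (subst Attr_unfold, blast)+
  have sub: "nodes_of H r \<subseteq> nodes_of G r" "color H = color G" for r
    by (subst HD(3), simp)+
  have succs: "succs H v = succs G v - (R p \<union> R (1 - p))" if "v \<in> nodes H" for v
    using that by (subst HD(3)) (subst remove_simps(4), subst (asm) HD(3), simp_all)
  have nH: "nodes H = nodes G - (R p \<union> R (1 - p))" by (subst HD(3)) simp
  have part: "nodes_of H r \<subseteq> nodes H" "nodes_of G r \<subseteq> nodes G" for r
    using parity_gameD(2) HD(1,2) by auto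
  note disj = parity_gameD(4)[OF HD(1) p2]
  have trapI: "trap (1 - p) G (R p \<union> B)"
    if B: "\<And>v. v \<in> B \<Longrightarrow> v \<in> nodes_of H p \<and> succs H v \<inter> B \<noteq> {} \<or>
           v \<in> nodes_of H (1 - p) \<and> succs H v \<subseteq> B"
      and "trap (1 - p) G (R p)" for B
    unfolding trap_def q
  proof (intro conjI ballI)
    show "R p \<union> B \<subseteq> nodes G" using won_subset[OF HD(4)] B part(1) nH by blast
  next
    fix v assume v: "v \<in> (R p \<union> B) \<inter> nodes_of G (1 - p)"
    show "succs G v \<subseteq> R p \<union> B"
    proof (cases "v \<in> R p")
      case True
      then show ?thesis using that(2) v unfolding trap_def by blast
    next
      case False
      then have "v \<in> nodes_of H (1 - p)" "succs H v \<subseteq> B" using B[of v] v disj sub(1) by blast+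
      then show ?thesis using HD(7)[of v] succs[of v] part(1) by blast
    qed
  next
    fix v assume v: "v \<in> (R p \<union> B) \<inter> nodes_of G p"
    show "succs G v \<inter> (R p \<union> B) \<noteq> {}"
    proof (cases "v \<in> R p")
      case True
      then show ?thesis using that(2) v unfolding trap_def q by blast
    next
      case False
      then have "v \<in> nodes_of H p" "succs H v \<inter> B \<noteq> {}" using B[of v] v disj sub(1) by blast+
      then show ?thesis using succs[of v] part(1) by blast
    qed
  qed
  \<comment> \<open>The last layer of a nonempty certificate records this for the whole set.\<close>
  have trapR: "trap (1 - p) G (R p)"
    using HD(4) by cases (auto simp: trap_def)
  \<comment> \<open>An opponent node of \<open>H\<close> in \<open>Q\<close> has a successor in
    \<open>Q\<close> outside both removed sets, hence along an edge of \<open>H\<close>; nodes of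
    \<open>p\<close> cannot leave \<open>Q\<close>. So a \<open>Q\<close> without nodes of
    \<open>X\<close> blocks the attraction in \<open>H\<close>.\<close>
  have avoid: "Q \<inter> X \<noteq> {}" if Q: "trap p G Q" "Q \<inter> R p = {}" "Q \<inter> A \<noteq> {}" for Q
  proof
    assume QX: "Q \<inter> X = {}"
    have own_avoid: "v \<notin> Q" if "v \<in> nodes_of H p" "w \<in> succs H v" "w \<notin> Q" for v w
      using that Q(1) sub(1) part(1) succs[of v] unfolding trap_def by blast
    have opp_avoid: "v \<notin> Q" if "v \<in> nodes_of H (1 - p)" "\<And>w. w \<in> succs H v \<Longrightarrow> w \<notin> Q" for v
    proof
      assume v: "v \<in> Q"
      have "v \<in> nodes_of G (1 - p)" using that(1) sub(1) by blast
      then have "succs G v \<inter> Q \<noteq> {}" using Q(1) v unfolding trap_def by blast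
      then obtain w where w: "w \<in> succs G v" "w \<in> Q" by blast
      have "w \<in> succs H v"
        using w HD(7)[OF that(1)] Q(2) succs[of v] part(1)[of "1 - p"] that(1) by blast
      then show False using that(2) w(2) by blast
    qed
    have ZQ: "v \<notin> Q" if "v \<in> ?Z" for v
      using that
    proof (induction rule: MAttr_induct)
      case (own v w)
      then show ?case using own_avoid[of v w] QX unfolding p by blast
    next
      case (opponent v)
      then show ?case using opp_avoid[of v] QX unfolding p by blast
    qed
    have "v \<notin> Q" if "v \<in> A" for v
      using that unfolding A
      by (induction rule: Attr_induct) (use ZQ own_avoid opp_avoid in blast)+
    then show False using Q(3) by blast
  qed
  have won: "won p G (R p \<union> A)"
  proof (rule won.layer[where X = X and Z = "?Z" and d = d])
    show "trap (1 - p) G (R p \<union> A)" by (rule trapI[OF A_cases trapR])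
    show "trap (1 - p) G (R p \<union> ?Z)" using Z by (intro trapI[OF _ trapR]) blast
    show "\<forall>v\<in>?Z. d \<le> color G v" using Z sub(2) by auto
    show "\<forall>v\<in>X. color G v = d" using Xd sub(2) by simp
    show "\<forall>Q. trap p G Q \<longrightarrow> Q \<inter> R p = {} \<longrightarrow> Q \<inter> A \<noteq> {} \<longrightarrow> Q \<inter> X \<noteq> {}" using avoid by blast
  qed (use HD(4) XZ ZA p in auto)
  have game: "parity_game (remove H A)"
  proof (rule parity_game_remove[OF HD(2)])
    fix v assume v: "v \<in> nodes H - A"
    then show "succs H v - A \<noteq> {}"
      using AI[of v] parity_gameD(3)[OF HD(2) p2] parity_gameD(6)[OF HD(2), of v] by blast
  qed
  have "remove H A = remove G (R p \<union> A \<union> R (1 - p))"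
    by (subst HD(3)) (simp add: Un_ac)
  moreover have "p = 0 \<or> p = 1" using p2 by auto
  ultimately have eq: "remove H A = remove G ((R(p := R p \<union> A)) 0 \<union> (R(p := R p \<union> A)) 1)"
    by (auto simp: Un_commute)
  \<comment> \<open>A surviving node of \<open>p\<close> with an edge into \<open>A\<close> would
    itself have been attracted.\<close>
  have "succs G v \<inter> (R p \<union> A) = {}" if "v \<in> nodes_of (remove H A) p" for v
    using that HD(6)[of v] AI(1)[of v] succs[of v] A_cases part(1) nH by auto blast
  moreover have "succs G v \<inter> R (1 - p) = {}" if "v \<in> nodes_of (remove H A) (1 - p)" for v
    using that HD(7)[of v] by simp
  moreover have "r = p \<or> r = 1 - p" if "r < 2" for r using that p2 by auto
  moreover have "1 - p \<noteq> p" by presburger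
  ultimately show ?thesis
    using won HD(1,5) game eq unfolding solved_def by (metis fun_upd_apply)
qed

section \<open>Comparison with a game without fatal attractors\<close>

text \<open>The moves of \<open>p\<close> inside \<open>A\<close> survive in \<open>K\<close>: they
  avoid \<open>S (1 - p)\<close> by disjointness of certificates, and \<open>S p\<close> because no
  node of \<open>p\<close> in \<open>K\<close> leads there. The opponent loses moves, but never all
  of them.\<close>

lemma update_disjoint_stuck:
  assumes H: "solved G R H" and K: "solved G S K" and KH: "nodes K \<subseteq> nodes H"
    and stuck: "\<forall>d Y. fatal K d Y \<longrightarrow> Y = {}"
    and fatal: "fatal H d X" and p: "p = d mod 2"
    and A: "A = Attr p H (MAttr H d X)"
  shows "nodes K \<inter> A = {}"
proof -
  have p2: "p < 2" using p by simp
  note HD = solvedD[OF H p2] and KD = solvedD[OF K p2]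
  let ?Z = "MAttr H d X" and ?Y = "X \<inter> nodes K"
  have "won p G (R p \<union> A)"
    using solvedD(4)[OF solved_update[OF H fatal p A] p2] by simp
  from won_disjoint[OF this KD(5) p2] have AS: "A \<inter> S (1 - p) = {}" by blast
  have XZ: "X \<subseteq> ?Z" using fatal unfolding fatal_def by auto
  have ZA: "?Z \<subseteq> A" unfolding A by (subst Attr_unfold) blast
  have nK: "nodes K = nodes G - (S p \<union> S (1 - p))" by (subst KD(3)) simp
  have ofH: "nodes_of H r = nodes_of G r - (R p \<union> R (1 - p))" for r by (subst HD(3)) simp
  have ofK: "nodes_of K r = nodes_of G r - (S p \<union> S (1 - p))" for r by (subst KD(3)) simp
  have col: "color K = color H" by (subst KD(3), subst HD(3)) simp
  have succsH: "succs H v = succs G v - (R p \<union> R (1 - p))" if "v \<in> nodes H" for v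
    using that by (subst HD(3)) (subst remove_simps(4), subst (asm) HD(3), simp_all)
  have succsK: "succs K v = succs G v - (S p \<union> S (1 - p))" if "v \<in> nodes K" for v
    using that by (subst KD(3)) (subst remove_simps(4), subst (asm) KD(3), simp_all)
  have nH: "nodes H = nodes G - (R p \<union> R (1 - p))" by (subst HD(3)) simp
  have to_K: "v \<in> nodes_of K r" if "v \<in> nodes_of H r" "v \<in> nodes K" for v r
    using that unfolding ofH ofK nK by blast
  have succsKH: "succs K v \<subseteq> succs H v" if "v \<in> nodes K" for v
    using that KH succsK[of v] succsH[of v] parity_gameD(5)[OF KD(2), of v] nH by blast
  have own_step: "w \<in> nodes K" "w \<in> succs K v"
    if "v \<in> nodes_of H p" "v \<in> nodes K" "w \<in> succs H v" "w \<in> A" for v w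
  proof -
    have "w \<in> succs G v" using that KH succsH[of v] by blast
    moreover have "w \<notin> S p" using KD(6)[OF to_K[OF that(1,2)]] calculation by blast
    ultimately show "w \<in> succs K v" using AS that(2,4) succsK[of v] by blast
    then show "w \<in> nodes K" using parity_gameD(5)[OF KD(2)] by blast
  qed
  have opp_step: "succs K v \<subseteq> succs H v \<inter> nodes K" "succs K v \<noteq> {}" if "v \<in> nodes K" for v
    using that succsKH parity_gameD(5,6)[OF KD(2), of v] by blast+
  have ZK: "v \<in> nodes K \<longrightarrow> v \<in> MAttr K d ?Y" if "v \<in> ?Z" for v
    using that
  proof (induction rule: MAttr_induct)
    case (own v w)
    show ?case
    proof
      assume v: "v \<in> nodes K"
      have "w \<in> A" using own(4) XZ ZA by blast
      then have "w \<in> nodes K" "w \<in> succs K v"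
        using own_step own(1,3) v p by blast+
      then have "v \<in> mpre K (d mod 2) (MAttr K d ?Y) ?Y d"
        using own(2,4) to_K[OF own(1) v] col unfolding mpre_def by auto
      then show "v \<in> MAttr K d ?Y" by (subst MAttr_unfold)
    qed
  next
    case (opponent v)
    show ?case
    proof
      assume v: "v \<in> nodes K"
      then have "v \<in> mpre K (d mod 2) (MAttr K d ?Y) ?Y d"
        using opponent(2,3) to_K[OF opponent(1) v] col opp_step(1)[OF v] unfolding mpre_def by auto
      then show "v \<in> MAttr K d ?Y" by (subst MAttr_unfold)
    qed
  qed
  have "fatal K d ?Y"
    using fatal XZ ZK col unfolding fatal_def by auto
  then have "?Y = {}" using stuck by blast
  \<comment> \<open>The target \<open>?Y\<close> being empty, its monotone attractor in
    \<open>K\<close> is empty too, so all of \<open>?Z\<close> misses \<open>K\<close>, not only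
    \<open>X\<close>.\<close>
  then have Z: "v \<notin> nodes K" if "v \<in> ?Z" for v
    using ZK[OF that] MAttr_empty[OF KD(2), of d] by auto
  have "v \<notin> nodes K" if "v \<in> A" for v
    using that unfolding A
  proof (induction rule: Attr_induct)
    case (target v)
    then show ?case by (rule Z)
  next
    case (own v w)
    then show ?case using own_step A by blast
  next
    case (opponent v)
    then show ?case using opp_step[of v] by blast
  qed
  then show ?thesis by blast
qed

section \<open>Runs of \<open>psolB\<close>, stability and uniqueness\<close>

lemma apply_color_cases:
  assumes "parity_game H"
  obtains "apply_color d H = H"
  | X where "fatal H d X" "apply_color d H = remove H (Attr (d mod 2) H (MAttr H d X))"
  using fatal_target(1)[OF assms, of d] unfolding apply_color_def Let_def by metis

lemma solved_parity_game: "solved G R H \<Longrightarrow> parity_game H"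
  unfolding solved_def by blast

lemma solved_psolB:
  assumes "solved G R H"
  shows "\<exists>R'. solved G R' (psolB \<pi> H)"
  using assms
proof (induction \<pi> arbitrary: R H)
  case Nil
  then show ?case by (auto simp: psolB_def)
next
  case (Cons d \<pi>)
  have "\<exists>R'. solved G R' (apply_color d H)"
    using solved_parity_game[OF Cons.prems]
    by (rule apply_color_cases[of H d]) (use Cons.prems solved_update in force)+
  then show ?case using Cons.IH by (auto simp: psolB_def)
qed

text \<open>\<open>H\<close> passes through the games of the run: \<open>solved_update\<close> keeps
  it solved, and \<open>update_disjoint_stuck\<close> keeps \<open>K\<close> inside it.\<close>

lemma stuck_subset_psolB:
  assumes "solved G R H" "solved G S K" "nodes K \<subseteq> nodes H"
    and "\<forall>d Y. fatal K d Y \<longrightarrow> Y = {}"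
  shows "nodes K \<subseteq> nodes (psolB \<pi> H)"
  using assms(1,3)
proof (induction \<pi> arbitrary: R H)
  case Nil
  then show ?case by (simp add: psolB_def)
next
  case (Cons d \<pi>)
  have "\<exists>R'. solved G R' (apply_color d H) \<and> nodes K \<subseteq> nodes (apply_color d H)"
    using solved_parity_game[OF Cons.prems(1)]
  proof (rule apply_color_cases[of H d])
    fix X assume X: "fatal H d X"
      "apply_color d H = remove H (Attr (d mod 2) H (MAttr H d X))"
    show ?thesis
      using solved_update[OF Cons.prems(1) X(1) refl refl]
        update_disjoint_stuck[OF Cons.prems(1) assms(2) Cons.prems(2) assms(4) X(1) refl refl]
        Cons.prems(2) X(2) by auto
  qed (use Cons.prems in auto)
  then show ?case using Cons.IH by (auto simp: psolB_def)
qed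

lemma solved_init:
  assumes "parity_game G"
  shows "solved G (\<lambda>_. {}) G"
proof -
  have "remove G {} = G" by (cases G) (simp add: remove_def)
  then show ?thesis using assms by (auto simp: solved_def won.empty)
qed

lemma stable_on_no_fatal:
  assumes "parity_game G" "stable_on G \<pi>" "fatal (psolB \<pi> G) d Y"
  shows "Y = {}"
proof (rule ccontr)
  assume Y: "Y \<noteq> {}"
  obtain R where R: "solved G R (psolB \<pi> G)"
    using solved_psolB[OF solved_init[OF assms(1)]] by blast
  then have "psolB \<pi> G = remove G (R 0 \<union> R 1)" by (simp add: solved_def)
  \<comment> \<open>Stability speaks of the colors of \<open>G\<close>; \<open>d\<close> is one of
    them, since the output is a restriction of \<open>G\<close> with the same coloring.\<close>
  then have "d \<in> colors G" using Y assms(3) unfolding fatal_def colors_def by auto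
  then have "apply_color d (psolB \<pi> G) = psolB \<pi> G"
    using assms(2) unfolding stable_on_def psolB_def by simp
  then have "Y = {}"
    by (rule no_fatal_if_apply_color_eq[OF solved_parity_game[OF R] _ assms(3)])
  with Y show False ..
qed

theorem theorem6:
  fixes G G1 G2 :: "'v game" and \<pi>1 \<pi>2 :: "nat list"
  assumes "parity_game G"
    and "set \<pi>1 \<subseteq> colors G" and "set \<pi>2 \<subseteq> colors G"
    and "stable_on G \<pi>1" and "stable_on G \<pi>2"
    and "G1 = psolB \<pi>1 G" and "G2 = psolB \<pi>2 G"
  shows "G1 = G2"
proof -
  note init = solved_init[OF assms(1)]
  have "\<exists>R. solved G R G1" "\<exists>S. solved G S G2"
    unfolding assms(6,7) by (rule solved_psolB[OF init])+
  then obtain R S where R: "solved G R G1" and S: "solved G S G2" by (elim exE)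
  have G1: "G1 = remove G (R 0 \<union> R 1)" "R 0 \<union> R 1 \<subseteq> nodes G"
    using solvedD(3-5)[OF R, of 0] won_subset[of _ G] by auto
  have G2: "G2 = remove G (S 0 \<union> S 1)" "S 0 \<union> S 1 \<subseteq> nodes G"
    using solvedD(3-5)[OF S, of 0] won_subset[of _ G] by auto
  \<comment> \<open>The run of \<open>\<pi>1\<close> starts at \<open>G\<close>, which contains the
    stable output \<open>G2\<close>, and so never removes a node of it.\<close>
  have "nodes G2 \<subseteq> nodes G1" unfolding assms(6)
    by (rule stuck_subset_psolB[OF init S])
      (use G2 stable_on_no_fatal[OF assms(1,5)] assms(7) in auto)
  moreover have "nodes G1 \<subseteq> nodes G2" unfolding assms(7)
    by (rule stuck_subset_psolB[OF init R])
      (use G1 stable_on_no_fatal[OF assms(1,4)] assms(6) in auto)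
  ultimately have "nodes G - (R 0 \<union> R 1) = nodes G - (S 0 \<union> S 1)"
    using G1(1) G2(1) by auto
  \<comment> \<open>Both removed sets lie in \<open>nodes G\<close>, so equal complements there make
    them equal.\<close>
  then have "R 0 \<union> R 1 = S 0 \<union> S 1" using G1(2) G2(2) by blast
  then show ?thesis using G1(1) G2(1) by simp
qed

end
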